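(* Let $R$ be an associative ring with unit and let $\mathfrak{F}$ be a Gabriel filter of right ideals of $R$. If $\mathfrak{F}$ is perfect, then $\mathfrak{F}$ is differential.
   Context: Modules are right modules unless stated otherwise. A derivation on $R$ is an additive map $\delta:R\to R$ with $\delta(rs)=\delta(r)s+r\delta(s)$ for all $r,s\in R$. Given a derivation $\delta$ on $R$, a $\delta$-derivation on a right $R$-module $M$ is an additive map $d:M\to M$ with $d(xr)=d(x)r+x\delta(r)$ for all $x\in M$, $r\in R$. For a right ideal $I$ and $r\in R$ put $(I:r)=\{s\in R : rs\in I\}$; for $m$ in a right module put $\mathrm{ann}(m)=\{r\in R: mr=0\}$. A Gabriel filter $\mathfrak{F}$ on $R$ is a nonempty collection of right ideals such that (1) if $I\in\mathfrak{F}$ and $r\in R$ then $(I:r)\in\mathfrak{F}$; (2) if $I\in\mathfrak{F}$ and $J$ is a right ideal with $(J:r)\in\mathfrak{F}$ for all $r\in I$, then $J\in\mathfrak{F}$. It determines a hereditary torsion theory whose torsion class $\mathcal{T}$ consists of the modules $M$ with $\mathrm{ann}(m)\in\mathfrak{F}$ for all $m\in M$. The torsion submodule of $M$ is $\mathcal{T}M=\{m\in M:\mathrm{ann}(m)\in\mathfrak{F}\}$. The Gabriel filter $\mathfrak{F}$ (and the torsion theory it determines) is differential if for every derivation $\delta$ on $R$ and every $I\in\mathfrak{F}$ there is $J\in\mathfrak{F}$ with $\delta(J)\subseteq I$. Equivalently, $d(\mathcal{T}M)\subseteq\mathcal{T}M$ for every right $R$-module $M$, every derivation $\delta$ on $R$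 and every $\delta$-derivation $d$ on $M$. The module of quotients $M_{\mathfrak{F}}$ is the largest submodule $N$ of the injective envelope $E(M/\mathcal{T}M)$ containing $M/\mathcal{T}M$ such that $N/(M/\mathcal{T}M)$ is torsion. $R_{\mathfrak{F}}$ carries a natural ring structure (the right ring of quotients) such that the canonical map $\phi_R:R\to R/\mathcal{T}R\hookrightarrow R_{\mathfrak{F}}$ is a ring homomorphism. The Gabriel filter $\mathfrak{F}$ is perfect if $\phi_R:R\to R_{\mathfrak{F}}$ is an epimorphism in the category of rings, $R_{\mathfrak{F}}$ is flat as a left $R$-module, and $\mathfrak{F}$ is exactly the set of right ideals $I$ of $R$ with $\phi_R(I)R_{\mathfrak{F}}=R_{\mathfrak{F}}$. *)

theory Defs
  imports
    "HOL-Algebra.Module"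
    "HOL-Algebra.Ideal_Product"
    "HOL-Algebra.Free_Abelian_Groups"
begin

text \<open>
  HOL-Algebra has left modules over commutative rings only.  As in its record \<open>module\<close>, the ring
  fields \<open>mult\<close> and \<open>one\<close> of a module carry no meaning.
\<close>

record ('a, 'b) right_module = "'b ring" +
  ract :: "'b \<Rightarrow> 'a \<Rightarrow> 'b"  (infixl "\<triangleleft>\<index>" 70)

locale right_module = R?: ring R + M?: abelian_group M for R (structure) and M (structure) +
  assumes ract_closed: "\<lbrakk>x \<in> carrier M; r \<in> carrier R\<rbrakk> \<Longrightarrow> x \<triangleleft>\<^bsub>M\<^esub> r \<in> carrier M"
    and ract_distr_module: "\<lbrakk>x \<in> carrier M; y \<in> carrier M; r \<in> carrier R\<rbrakk> \<Longrightarrow>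
      (x \<oplus>\<^bsub>M\<^esub> y) \<triangleleft>\<^bsub>M\<^esub> r = x \<triangleleft>\<^bsub>M\<^esub> r \<oplus>\<^bsub>M\<^esub> y \<triangleleft>\<^bsub>M\<^esub> r"
    and ract_distr_ring: "\<lbrakk>x \<in> carrier M; r \<in> carrier R; s \<in> carrier R\<rbrakk> \<Longrightarrow>
      x \<triangleleft>\<^bsub>M\<^esub> (r \<oplus>\<^bsub>R\<^esub> s) = x \<triangleleft>\<^bsub>M\<^esub> r \<oplus>\<^bsub>M\<^esub> x \<triangleleft>\<^bsub>M\<^esub> s"
    and ract_assoc: "\<lbrakk>x \<in> carrier M; r \<in> carrier R; s \<in> carrier R\<rbrakk> \<Longrightarrow>
      x \<triangleleft>\<^bsub>M\<^esub> (r \<otimes>\<^bsub>R\<^esub> s) = (x \<triangleleft>\<^bsub>M\<^esub> r) \<triangleleft>\<^bsub>M\<^esub> s"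
    and ract_one: "x \<in> carrier M \<Longrightarrow> x \<triangleleft>\<^bsub>M\<^esub> \<one>\<^bsub>R\<^esub> = x"

text \<open>The axioms of the library locale \<open>module\<close>, over a ring that need not be commutative.\<close>

locale left_module = R?: ring R + M?: abelian_group M for R (structure) and M (structure) +
  assumes smult_closed: "\<lbrakk>r \<in> carrier R; x \<in> carrier M\<rbrakk> \<Longrightarrow> r \<odot>\<^bsub>M\<^esub> x \<in> carrier M"
    and smult_distr_ring: "\<lbrakk>r \<in> carrier R; s \<in> carrier R; x \<in> carrier M\<rbrakk> \<Longrightarrow>
      (r \<oplus>\<^bsub>R\<^esub> s) \<odot>\<^bsub>M\<^esub> x = r \<odot>\<^bsub>M\<^esub> x \<oplus>\<^bsub>M\<^esub> s \<odot>\<^bsub>M\<^esub> x"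
    and smult_distr_module: "\<lbrakk>r \<in> carrier R; x \<in> carrier M; y \<in> carrier M\<rbrakk> \<Longrightarrow>
      r \<odot>\<^bsub>M\<^esub> (x \<oplus>\<^bsub>M\<^esub> y) = r \<odot>\<^bsub>M\<^esub> x \<oplus>\<^bsub>M\<^esub> r \<odot>\<^bsub>M\<^esub> y"
    and smult_assoc: "\<lbrakk>r \<in> carrier R; s \<in> carrier R; x \<in> carrier M\<rbrakk> \<Longrightarrow>
      (r \<otimes>\<^bsub>R\<^esub> s) \<odot>\<^bsub>M\<^esub> x = r \<odot>\<^bsub>M\<^esub> (s \<odot>\<^bsub>M\<^esub> x)"
    and smult_one: "x \<in> carrier M \<Longrightarrow> \<one>\<^bsub>R\<^esub> \<odot>\<^bsub>M\<^esub> x = x"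

definition right_regular :: "('a, 'm) ring_scheme \<Rightarrow> ('a, 'a) right_module" where
  "right_regular R = \<lparr>carrier = carrier R, monoid.mult = monoid.mult R, one = \<one>\<^bsub>R\<^esub>,
     ring.zero = \<zero>\<^bsub>R\<^esub>, ring.add = ring.add R, ract = monoid.mult R\<rparr>"

definition right_submodule ::
    "('a, 'm) ring_scheme \<Rightarrow> 'b set \<Rightarrow> ('a, 'b, 'n) right_module_scheme \<Rightarrow> bool" where
  "right_submodule R N M \<longleftrightarrow>
     additive_subgroup N M \<and> (\<forall>x\<in>N. \<forall>r\<in>carrier R. x \<triangleleft>\<^bsub>M\<^esub> r \<in> N)"

definition right_ideal :: "'a set \<Rightarrow> ('a, 'm) ring_scheme \<Rightarrow> bool" where
  "right_ideal I R \<longleftrightarrow> right_submodule R I (right_regular R)"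

text \<open>All representatives \<open>x\<close> of a coset give the same coset \<open>N +> (x \<triangleleft> r)\<close>, so the union below
  is just that coset.\<close>

definition quotient_module ::
    "('a, 'b, 'n) right_module_scheme \<Rightarrow> 'b set \<Rightarrow> ('a, 'b set) right_module" where
  "quotient_module M N = \<lparr>carrier = a_rcosets\<^bsub>M\<^esub> N, monoid.mult = undefined, one = undefined,
     ring.zero = N, ring.add = set_add M, ract = (\<lambda>X r. \<Union>x\<in>X. N +>\<^bsub>M\<^esub> (x \<triangleleft>\<^bsub>M\<^esub> r))\<rparr>"

definition right_module_hom :: "('a, 'm) ring_scheme \<Rightarrow> ('a, 'b, 'n) right_module_scheme \<Rightarrow>
    ('a, 'c, 'k) right_module_scheme \<Rightarrow> ('b \<Rightarrow> 'c) set" where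
  "right_module_hom R M N = {f. f \<in> carrier M \<rightarrow> carrier N \<and>
     (\<forall>x\<in>carrier M. \<forall>y\<in>carrier M. f (x \<oplus>\<^bsub>M\<^esub> y) = f x \<oplus>\<^bsub>N\<^esub> f y) \<and>
     (\<forall>x\<in>carrier M. \<forall>r\<in>carrier R. f (x \<triangleleft>\<^bsub>M\<^esub> r) = f x \<triangleleft>\<^bsub>N\<^esub> r)}"

definition annihilator ::
    "('a, 'm) ring_scheme \<Rightarrow> ('a, 'b, 'n) right_module_scheme \<Rightarrow> 'b \<Rightarrow> 'a set" where
  "annihilator R M x = {r \<in> carrier R. x \<triangleleft>\<^bsub>M\<^esub> r = \<zero>\<^bsub>M\<^esub>}"

definition residual :: "('a, 'm) ring_scheme \<Rightarrow> 'a set \<Rightarrow> 'a \<Rightarrow> 'a set" where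
  "residual R I r = {s \<in> carrier R. r \<otimes>\<^bsub>R\<^esub> s \<in> I}"

definition gabriel_filter :: "('a, 'm) ring_scheme \<Rightarrow> 'a set set \<Rightarrow> bool" where
  "gabriel_filter R F \<longleftrightarrow> F \<noteq> {} \<and> (\<forall>I\<in>F. right_ideal I R) \<and>
     (\<forall>I\<in>F. \<forall>r\<in>carrier R. residual R I r \<in> F) \<and>
     (\<forall>I\<in>F. \<forall>J. right_ideal J R \<and> (\<forall>r\<in>I. residual R J r \<in> F) \<longrightarrow> J \<in> F)"

definition torsion_submodule ::
    "('a, 'm) ring_scheme \<Rightarrow> 'a set set \<Rightarrow> ('a, 'b, 'n) right_module_scheme \<Rightarrow> 'b set" where
  "torsion_submodule R F M = {x \<in> carrier M. annihilator R M x \<in> F}"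

definition torsion_module ::
    "('a, 'm) ring_scheme \<Rightarrow> 'a set set \<Rightarrow> ('a, 'b, 'n) right_module_scheme \<Rightarrow> bool" where
  "torsion_module R F M \<longleftrightarrow> (\<forall>x\<in>carrier M. annihilator R M x \<in> F)"

definition ring_derivation :: "('a, 'm) ring_scheme \<Rightarrow> ('a \<Rightarrow> 'a) \<Rightarrow> bool" where
  "ring_derivation R \<delta> \<longleftrightarrow> \<delta> \<in> carrier R \<rightarrow> carrier R \<and>
     (\<forall>r\<in>carrier R. \<forall>s\<in>carrier R. \<delta> (r \<oplus>\<^bsub>R\<^esub> s) = \<delta> r \<oplus>\<^bsub>R\<^esub> \<delta> s) \<and>
     (\<forall>r\<in>carrier R. \<forall>s\<in>carrier R. \<delta> (r \<otimes>\<^bsub>R\<^esub> s) = \<delta> r \<otimes>\<^bsub>R\<^esub> s \<oplus>\<^bsub>R\<^esub> r \<otimes>\<^bsub>R\<^esub> \<delta> s)"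

definition differential_filter :: "('a, 'm) ring_scheme \<Rightarrow> 'a set set \<Rightarrow> bool" where
  "differential_filter R F \<longleftrightarrow>
     (\<forall>\<delta>. ring_derivation R \<delta> \<longrightarrow> (\<forall>I\<in>F. \<exists>J\<in>F. \<delta> ` J \<subseteq> I))"

text \<open>
  Injectivity, flatness and epimorphisms are defined by test objects.  HOL cannot quantify over
  types inside a definition, so the test objects live on a fixed carrier type that is large
  enough for the tested notion not to depend on the choice:
  \<^item> injectivity: by Baer's criterion it is enough to test the inclusions of right ideals into
    \<open>R\<close>, and these have isomorphic copies on \<open>'a list\<close>;
  \<^item> flatness: an element of \<open>A \<otimes> L\<close> that becomes zero in \<open>B \<otimes> L\<close> already does so for finitely
    generated submodules of \<open>A\<close> and \<open>B\<close>.  Those have at most \<open>max |R| \<aleph>\<^sub>0\<close> elements, hence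
    isomorphic copies on the infinite type \<open>'a list\<close>;
  \<^item> epimorphisms: a pair of ring homomorphisms \<open>g, h\<close> out of \<open>Q\<close> factors through the subring
    generated by their images, which has at most \<open>max |Q| \<aleph>\<^sub>0\<close> elements, hence an
    isomorphic copy on the lists over the carrier type of \<open>Q\<close>.
\<close>

definition injective_module ::
    "('a, 'm) ring_scheme \<Rightarrow> ('a, 'b, 'n) right_module_scheme \<Rightarrow> bool" where
  "injective_module R E \<longleftrightarrow> right_module R E \<and>
     (\<forall>(A :: ('a, 'a list) right_module) (B :: ('a, 'a list) right_module) f g.
        right_module R A \<and> right_module R B \<and>
        f \<in> right_module_hom R A B \<and> inj_on f (carrier A) \<and> g \<in> right_module_hom R A E
        \<longrightarrow> (\<exists>h \<in> right_module_hom R B E. \<forall>x\<in>carrier A. h (f x) = g x))"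

definition injective_envelope :: "('a, 'm) ring_scheme \<Rightarrow> ('a, 'b, 'n) right_module_scheme \<Rightarrow>
    ('a, 'e, 'k) right_module_scheme \<Rightarrow> ('b \<Rightarrow> 'e) \<Rightarrow> bool" where
  "injective_envelope R M E j \<longleftrightarrow> injective_module R E \<and>
     j \<in> right_module_hom R M E \<and> inj_on j (carrier M) \<and>
     (\<forall>N. right_submodule R N E \<and> N \<inter> j ` carrier M = {\<zero>\<^bsub>E\<^esub>} \<longrightarrow> N = {\<zero>\<^bsub>E\<^esub>})"

text \<open>The module of quotients of \<open>M\<close>, as a subset of an injective envelope \<open>(E, j)\<close> of \<open>M / TM\<close>.\<close>

definition torsion_extension_in :: "('a, 'm) ring_scheme \<Rightarrow> 'a set set \<Rightarrow>
    ('a, 'e, 'k) right_module_scheme \<Rightarrow> 'e set \<Rightarrow> 'e set \<Rightarrow> bool" where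
  "torsion_extension_in R F E M' N \<longleftrightarrow> right_submodule R N E \<and> M' \<subseteq> N \<and>
     torsion_module R F (quotient_module (E\<lparr>carrier := N\<rparr>) M')"

definition module_of_quotients :: "('a, 'm) ring_scheme \<Rightarrow> 'a set set \<Rightarrow>
    ('a, 'b, 'n) right_module_scheme \<Rightarrow> ('a, 'e, 'k) right_module_scheme \<Rightarrow> ('b set \<Rightarrow> 'e) \<Rightarrow>
    'e set \<Rightarrow> bool" where
  "module_of_quotients R F M E j N \<longleftrightarrow>
     (let M\<^sub>0 = quotient_module M (torsion_submodule R F M) in
      injective_envelope R M\<^sub>0 E j \<and>
      torsion_extension_in R F E (j ` carrier M\<^sub>0) N \<and>
      (\<forall>N'. torsion_extension_in R F E (j ` carrier M\<^sub>0) N' \<longrightarrow> N' \<subseteq> N))"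

text \<open>The composite of \<open>R \<rightarrow> R / TR\<close> with the embedding \<open>j\<close> of \<open>R / TR\<close>.\<close>

definition canonical_map ::
    "('a, 'm) ring_scheme \<Rightarrow> 'a set set \<Rightarrow> ('a set \<Rightarrow> 'e) \<Rightarrow> 'a \<Rightarrow> 'e" where
  "canonical_map R F j r = j (torsion_submodule R F (right_regular R) +>\<^bsub>R\<^esub> r)"

text \<open>
  \<open>Q\<close> is the module of quotients of \<open>R\<close> with its natural ring structure: it has the addition of
  \<open>E\<close>, the canonical map is a ring homomorphism, and restriction of scalars along that map gives
  back the right \<open>R\<close>-action of \<open>E\<close>.  This determines the product \<open>q \<otimes> x\<close>, because \<open>Q\<close> is
  torsion-free and, for all \<open>r\<close> in some member of \<open>F\<close>, \<open>x \<triangleleft> r\<close> is the image of an element of \<open>R\<close>.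
\<close>

definition right_ring_of_quotients :: "('a, 'm) ring_scheme \<Rightarrow> 'a set set \<Rightarrow>
    ('a, 'e, 'k) right_module_scheme \<Rightarrow> ('a set \<Rightarrow> 'e) \<Rightarrow> ('e, 'q) ring_scheme \<Rightarrow> bool" where
  "right_ring_of_quotients R F E j Q \<longleftrightarrow>
     module_of_quotients R F (right_regular R) E j (carrier Q) \<and>
     ring Q \<and>
     (\<forall>x\<in>carrier Q. \<forall>y\<in>carrier Q. x \<oplus>\<^bsub>Q\<^esub> y = x \<oplus>\<^bsub>E\<^esub> y) \<and>
     canonical_map R F j \<in> ring_hom R Q \<and>
     (\<forall>q\<in>carrier Q. \<forall>r\<in>carrier R. q \<otimes>\<^bsub>Q\<^esub> canonical_map R F j r = q \<triangleleft>\<^bsub>E\<^esub> r)"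

definition ring_epimorphism ::
    "('a, 'm) ring_scheme \<Rightarrow> ('b, 'n) ring_scheme \<Rightarrow> ('a \<Rightarrow> 'b) \<Rightarrow> bool" where
  "ring_epimorphism R Q \<phi> \<longleftrightarrow> \<phi> \<in> ring_hom R Q \<and>
     (\<forall>(S :: 'b list ring) g h. ring S \<and> g \<in> ring_hom Q S \<and> h \<in> ring_hom Q S \<and>
        (\<forall>r\<in>carrier R. g (\<phi> r) = h (\<phi> r)) \<longrightarrow> (\<forall>q\<in>carrier Q. g q = h q))"

text \<open>The tensor product \<open>M \<otimes>\<^sub>R L\<close> of a right and a left module, as a multiplicatively written
  quotient of the free abelian group on \<open>M \<times> L\<close>.\<close>

definition tensor_relations :: "('a, 'm) ring_scheme \<Rightarrow> ('a, 'b, 'n) right_module_scheme \<Rightarrow>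
    ('a, 'c, 'k) module_scheme \<Rightarrow> ('b \<times> 'c \<Rightarrow>\<^sub>0 int) set" where
  "tensor_relations R M L = generate (free_Abelian_group (carrier M \<times> carrier L))
     ({frag_of (x \<oplus>\<^bsub>M\<^esub> x', y) - frag_of (x, y) - frag_of (x', y) | x x' y.
         x \<in> carrier M \<and> x' \<in> carrier M \<and> y \<in> carrier L} \<union>
      {frag_of (x, y \<oplus>\<^bsub>L\<^esub> y') - frag_of (x, y) - frag_of (x, y') | x y y'.
         x \<in> carrier M \<and> y \<in> carrier L \<and> y' \<in> carrier L} \<union>
      {frag_of (x \<triangleleft>\<^bsub>M\<^esub> r, y) - frag_of (x, r \<odot>\<^bsub>L\<^esub> y) | x r y.
         x \<in> carrier M \<and> r \<in> carrier R \<and> y \<in> carrier L})"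

definition tensor_product :: "('a, 'm) ring_scheme \<Rightarrow> ('a, 'b, 'n) right_module_scheme \<Rightarrow>
    ('a, 'c, 'k) module_scheme \<Rightarrow> ('b \<times> 'c \<Rightarrow>\<^sub>0 int) set monoid" where
  "tensor_product R M L =
     free_Abelian_group (carrier M \<times> carrier L) Mod tensor_relations R M L"

text \<open>The map \<open>f \<otimes> L\<close> from \<open>A \<otimes>\<^sub>R L\<close> to \<open>B \<otimes>\<^sub>R L\<close>; again, all representatives of a coset contribute
  the same coset.\<close>

definition tensor_map :: "('a, 'm) ring_scheme \<Rightarrow> ('a, 'b, 'n) right_module_scheme \<Rightarrow>
    ('a, 'c, 'k) module_scheme \<Rightarrow> ('d \<Rightarrow> 'b) \<Rightarrow> ('d \<times> 'c \<Rightarrow>\<^sub>0 int) set \<Rightarrow> ('b \<times> 'c \<Rightarrow>\<^sub>0 int) set" where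
  "tensor_map R B L f X = (\<Union>c\<in>X. tensor_relations R B L
     #>\<^bsub>free_Abelian_group (carrier B \<times> carrier L)\<^esub> frag_extend (\<lambda>(x, y). frag_of (f x, y)) c)"

definition flat_left_module ::
    "('a, 'm) ring_scheme \<Rightarrow> ('a, 'c, 'k) module_scheme \<Rightarrow> bool" where
  "flat_left_module R L \<longleftrightarrow> left_module R L \<and>
     (\<forall>(A :: ('a, 'a list) right_module) (B :: ('a, 'a list) right_module) f.
        right_module R A \<and> right_module R B \<and>
        f \<in> right_module_hom R A B \<and> inj_on f (carrier A)
        \<longrightarrow> inj_on (tensor_map R B L f) (carrier (tensor_product R A L)))"

definition left_module_along :: "('a \<Rightarrow> 'b) \<Rightarrow> ('b, 'n) ring_scheme \<Rightarrow> ('a, 'b) module" where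
  "left_module_along \<phi> Q = \<lparr>carrier = carrier Q, monoid.mult = monoid.mult Q, one = \<one>\<^bsub>Q\<^esub>,
     ring.zero = \<zero>\<^bsub>Q\<^esub>, ring.add = ring.add Q, smult = (\<lambda>r q. \<phi> r \<otimes>\<^bsub>Q\<^esub> q)\<rparr>"

text \<open>To be used with \<open>Q\<close> the right ring of quotients of \<open>R\<close> and \<open>\<phi>\<close> the canonical map.  Despite
  its name, \<open>ideal_prod\<close> is defined for arbitrary subsets, as the set of finite sums of products.\<close>

definition perfect_filter ::
    "('a, 'm) ring_scheme \<Rightarrow> 'a set set \<Rightarrow> ('b, 'n) ring_scheme \<Rightarrow> ('a \<Rightarrow> 'b) \<Rightarrow> bool" where
  "perfect_filter R F Q \<phi> \<longleftrightarrow>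
     ring_epimorphism R Q \<phi> \<and>
     flat_left_module R (left_module_along \<phi> Q) \<and>
     F = {I. right_ideal I R \<and> ideal_prod Q (\<phi> ` I) (carrier Q) = carrier Q}"

end

theory Submission
  imports Defs
begin

text \<open>
  A Gabriel filter is differential as soon as each of its members contains a finitely generated
  member.  Let \<open>I \<in> F\<close> contain the member \<open>AR\<close> with \<open>A\<close> finite.  By the Leibniz rule
  \<open>\<delta> (a k) = \<delta> a k + a \<delta> k\<close> with \<open>a \<in> A\<close>.  The second summand always lies in \<open>I\<close>, and the first one
  does if \<open>k\<close> belongs to \<open>K = (\<Inter>a\<in>A. (I : \<delta> a))\<close>, which is in \<open>F\<close> since \<open>A\<close> is finite.
  Hence \<open>\<delta>\<close> maps \<open>AK\<close> into \<open>I\<close>, and \<open>AK\<close> is in \<open>F\<close> because \<open>AR\<close> and \<open>K\<close> are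
  (\<open>gabriel_filter_ideal_prod\<close>).

  A perfect filter has this property: its members are the right ideals \<open>I\<close> with \<open>\<phi>(I) Q = Q\<close>,
  and that equation only says that \<open>1\<close> is a finite sum \<open>\<Sum>i. \<phi>(a\<^sub>i) q\<^sub>i\<close> with all \<open>a\<^sub>i\<close> in \<open>I\<close>.
  The right ideal generated by the \<open>a\<^sub>i\<close> satisfies it as well.

  Finite sums of products are the elements of \<open>ideal_prod\<close>, so \<open>ideal_prod R A (carrier R)\<close> is the
  right ideal generated by a nonempty set \<open>A\<close>.
\<close>

section \<open>Right ideals and finite sums of products\<close>

text \<open>Negatives need no separate condition: \<open>- x\<close> is \<open>x (- 1)\<close>.\<close>

lemma right_ideal_iff:
  fixes R (structure)
  assumes "ring R"
  shows "right_ideal I R \<longleftrightarrow> I \<subseteq> carrier R \<and> \<zero> \<in> I \<and>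
    (\<forall>x\<in>I. \<forall>y\<in>I. x \<oplus> y \<in> I) \<and> (\<forall>x\<in>I. \<forall>r\<in>carrier R. x \<otimes> r \<in> I)"
    (is "_ \<longleftrightarrow> ?closed")
proof -
  interpret ring R by fact
  have additive: "additive_subgroup I (right_regular R) \<longleftrightarrow> additive_subgroup I R"
    by (simp add: additive_subgroup_def subgroup_def right_regular_def m_inv_def)
  have "additive_subgroup I R" if c: ?closed
  proof -
    have "\<ominus> x \<in> I" if "x \<in> I" for x
    proof -
      have "x \<otimes> \<ominus> \<one> \<in> I" "x \<in> carrier R"
        using c that by auto
      then show ?thesis by (simp add: r_minus)
    qed
    then show ?thesis
      using c by (simp add: additive_subgroup_def subgroup_def a_inv_def)
  qed
  then show ?thesis
    unfolding right_ideal_def right_submodule_def additive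
    by (auto simp: right_regular_def additive_subgroup_def subgroup_def)
qed

lemma ideal_prod_mono:
  assumes "x \<in> ideal_prod R A B" "A \<subseteq> A'" "B \<subseteq> B'"
  shows "x \<in> ideal_prod R A' B'"
  using assms(1) by induction (use assms in \<open>auto intro: ideal_prod.intros\<close>)

lemma ideal_prod_right_ideal:
  fixes R (structure)
  assumes "ring R" "A \<subseteq> carrier R" "A \<noteq> {}" "right_ideal K R"
  shows "right_ideal (ideal_prod R A K) R"
proof -
  interpret ring R by fact
  have K: "K \<subseteq> carrier R" "\<zero> \<in> K" "\<And>k r. k \<in> K \<Longrightarrow> r \<in> carrier R \<Longrightarrow> k \<otimes> r \<in> K"
    using assms(4) by (auto simp: right_ideal_iff[OF \<open>ring R\<close>])
  have closed: "x \<in> carrier R" if "x \<in> ideal_prod R A K" for x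
    using that by induction (use assms K in auto)
  have "\<zero> \<in> ideal_prod R A K"
  proof -
    obtain a where "a \<in> A" using assms by auto
    then have "a \<otimes> \<zero> \<in> ideal_prod R A K" "a \<in> carrier R"
      using K assms by (auto intro: ideal_prod.intros)
    then show ?thesis by simp
  qed
  moreover have "x \<otimes> r \<in> ideal_prod R A K"
    if "x \<in> ideal_prod R A K" and r: "r \<in> carrier R" for x r
    using that(1)
  proof induction
    case (prod a k)
    then have "a \<otimes> (k \<otimes> r) \<in> ideal_prod R A K"
      using K r by (auto intro: ideal_prod.prod)
    moreover have "a \<in> carrier R" "k \<in> carrier R"
      using prod K assms by auto
    ultimately show ?case using r by (simp add: m_assoc)
  next
    case (sum x y)
    then show ?case
      using closed r by (simp add: l_distr ideal_prod.sum)
  qed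
  ultimately show ?thesis
    unfolding right_ideal_iff[OF \<open>ring R\<close>] using closed by (auto intro: ideal_prod.sum)
qed

text \<open>Finitely many elements of \<open>A\<close> enter into a finite sum of products.\<close>

lemma ideal_prod_finite_support:
  assumes "x \<in> ideal_prod Q (f ` A) B"
  obtains A' where "finite A'" "A' \<subseteq> A" "A' \<noteq> {}" "x \<in> ideal_prod Q (f ` A') B"
proof -
  have "\<exists>A'. finite A' \<and> A' \<subseteq> A \<and> A' \<noteq> {} \<and> x \<in> ideal_prod Q (f ` A') B"
    using assms
  proof induction
    case (prod i b)
    then obtain a where "a \<in> A" "i = f a" by auto
    then show ?case
      using prod by (intro exI[of _ "{a}"]) (auto intro: ideal_prod.prod)
  next
    case (sum x y)
    then obtain A1 A2 where
      "finite A1" "A1 \<subseteq> A" "A1 \<noteq> {}" "x \<in> ideal_prod Q (f ` A1) B"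
      "finite A2" "A2 \<subseteq> A" "y \<in> ideal_prod Q (f ` A2) B" by auto
    moreover from this have
      "x \<in> ideal_prod Q (f ` (A1 \<union> A2)) B" "y \<in> ideal_prod Q (f ` (A1 \<union> A2)) B"
      by (meson ideal_prod_mono Un_upper1 Un_upper2 image_mono order_refl)+
    ultimately show ?case
      by (intro exI[of _ "A1 \<union> A2"]) (auto intro: ideal_prod.sum)
  qed
  then show ?thesis using that by auto
qed

lemma residual_right_ideal:
  assumes "ring R" "right_ideal I R" "r \<in> carrier R"
  shows "right_ideal (residual R I r) R"
proof -
  interpret ring R by fact
  show ?thesis
    using assms(2,3) unfolding right_ideal_iff[OF \<open>ring R\<close>]
    by (auto simp: residual_def r_distr m_assoc[symmetric])
qed

lemma right_ideal_Int:
  assumes "ring R" "right_ideal I R" "right_ideal J R"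
  shows "right_ideal (I \<inter> J) R"
  using assms by (auto simp: right_ideal_iff)

section \<open>Closure properties of Gabriel filters\<close>

lemma gabriel_filter_right_ideal:
  "gabriel_filter R F \<Longrightarrow> I \<in> F \<Longrightarrow> right_ideal I R"
  unfolding gabriel_filter_def by blast

lemma gabriel_filter_subset_carrier:
  "ring R \<Longrightarrow> gabriel_filter R F \<Longrightarrow> I \<in> F \<Longrightarrow> I \<subseteq> carrier R"
  using gabriel_filter_right_ideal[of R F I] by (simp add: right_ideal_iff)

lemma gabriel_filter_residual:
  "gabriel_filter R F \<Longrightarrow> I \<in> F \<Longrightarrow> r \<in> carrier R \<Longrightarrow> residual R I r \<in> F"
  unfolding gabriel_filter_def by blast

lemma gabriel_filter_local:
  assumes "gabriel_filter R F" "I \<in> F" "right_ideal J R" "\<And>r. r \<in> I \<Longrightarrow> residual R J r \<in> F"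
  shows "J \<in> F"
  using assms unfolding gabriel_filter_def by blast

lemma gabriel_filter_superset:
  assumes "ring R" "gabriel_filter R F" "I \<in> F" "right_ideal J R" "I \<subseteq> J"
  shows "J \<in> F"
proof (rule gabriel_filter_local[OF assms(2-4)])
  fix r assume r: "r \<in> I"
  have "right_ideal I R"
    by (rule gabriel_filter_right_ideal[OF assms(2,3)])
  \<comment> \<open>Both residuals are the whole ring, as \<open>r\<close> lies in both right ideals.\<close>
  then have "residual R J r = residual R I r" "r \<in> carrier R"
    using r assms by (auto simp: residual_def right_ideal_iff)
  then show "residual R J r \<in> F"
    using assms gabriel_filter_residual by metis
qed

lemma gabriel_filter_Int:
  assumes "ring R" "gabriel_filter R F" "I \<in> F" "J \<in> F"
  shows "I \<inter> J \<in> F"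
proof (rule gabriel_filter_local[OF assms(2,3)])
  have I: "right_ideal I R" "right_ideal J R"
    by (rule gabriel_filter_right_ideal[OF assms(2)], fact)+
  then show "right_ideal (I \<inter> J) R"
    using assms(1) by (simp add: right_ideal_Int)
  fix r assume "r \<in> I"
  then have "residual R (I \<inter> J) r = residual R J r" "r \<in> carrier R"
    using I by (auto simp: residual_def right_ideal_iff[OF assms(1)])
  then show "residual R (I \<inter> J) r \<in> F"
    using assms gabriel_filter_residual by metis
qed

text \<open>The carrier takes care of the empty intersection, which is the set of all elements of the
  type and not just of the ring.\<close>

lemma gabriel_filter_finite_Inter:
  assumes "ring R" "gabriel_filter R F" "finite A" "\<And>a. a \<in> A \<Longrightarrow> I a \<in> F"
  shows "carrier R \<inter> (\<Inter>a\<in>A. I a) \<in> F"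
  using assms(3,4)
proof (induction A rule: finite_induct)
  case empty
  interpret ring R by fact
  obtain J where "J \<in> F"
    using assms(2) by (auto simp: gabriel_filter_def)
  moreover from this have "J \<subseteq> carrier R"
    by (rule gabriel_filter_subset_carrier[OF assms(1,2)])
  moreover have "right_ideal (carrier R) R"
    by (simp add: right_ideal_iff[OF assms(1)])
  ultimately show ?case
    using gabriel_filter_superset[OF assms(1,2)] by simp
next
  case (insert a A)
  then have "I a \<inter> (carrier R \<inter> (\<Inter>a\<in>A. I a)) \<in> F"
    using gabriel_filter_Int[OF assms(1,2)] by auto
  then show ?case by (simp add: Int_left_commute)
qed

text \<open>For \<open>x = \<Sum>i. a\<^sub>i r\<^sub>i\<close> in \<open>AR\<close> the residual \<open>(AK : x)\<close> contains the finite intersection of the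
  residuals \<open>(K : r\<^sub>i)\<close>, so the second axiom of a Gabriel filter, with \<open>AR\<close> as the given member,
  applies to \<open>AK\<close>.\<close>

lemma gabriel_filter_ideal_prod:
  fixes R (structure)
  assumes "ring R" "gabriel_filter R F" "A \<subseteq> carrier R" "A \<noteq> {}"
    and "ideal_prod R A (carrier R) \<in> F" "K \<in> F"
  shows "ideal_prod R A K \<in> F"
proof (rule gabriel_filter_local[OF assms(2,5)])
  interpret ring R by fact
  have K: "right_ideal K R"
    by (rule gabriel_filter_right_ideal[OF assms(2,6)])
  show AK: "right_ideal (ideal_prod R A K) R"
    by (rule ideal_prod_right_ideal[OF assms(1,3,4) K])
  have closed: "ideal_prod R A (carrier R) \<subseteq> carrier R"
    by (rule gabriel_filter_subset_carrier[OF assms(1,2,5)])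
  fix x assume "x \<in> ideal_prod R A (carrier R)"
  then show "residual R (ideal_prod R A K) x \<in> F"
  proof induction
    case (prod a r)
    then have a: "a \<in> carrier R" using assms by auto
    have "residual R K r \<subseteq> residual R (ideal_prod R A K) (a \<otimes> r)"
      using prod a by (auto simp: residual_def m_assoc intro: ideal_prod.prod)
    then show ?case
      using gabriel_filter_superset[OF assms(1,2) gabriel_filter_residual[OF assms(2,6)]]
        residual_right_ideal[OF assms(1) AK] prod a by simp
  next
    case (sum x y)
    then have xy: "x \<in> carrier R" "y \<in> carrier R" using closed by auto
    have "residual R (ideal_prod R A K) x \<inter> residual R (ideal_prod R A K) y
        \<subseteq> residual R (ideal_prod R A K) (x \<oplus> y)"
      using xy by (auto simp: residual_def l_distr intro: ideal_prod.sum)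
    then show ?case
      using gabriel_filter_superset[OF assms(1,2) gabriel_filter_Int[OF assms(1,2) sum.IH]]
        residual_right_ideal[OF assms(1) AK] xy by simp
  qed
qed

section \<open>Filters with enough finitely generated members\<close>

text \<open>The witness for \<open>I\<close> is \<open>AK\<close>, where \<open>K\<close> consists of the \<open>k\<close> with \<open>\<delta> a k \<in> I\<close> for all \<open>a \<in> A\<close>.
  Finiteness of \<open>A\<close> is what puts \<open>K\<close> into \<open>F\<close>.\<close>

lemma differential_if_finitely_generated_members:
  fixes R (structure)
  assumes "ring R" "gabriel_filter R F"
    and fin_gen: "\<And>I. I \<in> F \<Longrightarrow>
      \<exists>A. finite A \<and> A \<noteq> {} \<and> A \<subseteq> I \<and> ideal_prod R A (carrier R) \<in> F"
  shows "differential_filter R F"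
  unfolding differential_filter_def
proof (intro allI impI ballI)
  interpret ring R by fact
  fix \<delta> I
  assume \<delta>: "ring_derivation R \<delta>" and I: "I \<in> F"
  obtain A where A: "finite A" "A \<noteq> {}" "A \<subseteq> I" "ideal_prod R A (carrier R) \<in> F"
    using fin_gen[OF I] by blast
  have I': "I \<subseteq> carrier R" "\<And>x y. x \<in> I \<Longrightarrow> y \<in> I \<Longrightarrow> x \<oplus> y \<in> I"
    "\<And>x r. x \<in> I \<Longrightarrow> r \<in> carrier R \<Longrightarrow> x \<otimes> r \<in> I"
    using gabriel_filter_right_ideal[OF assms(2) I] by (auto simp: right_ideal_iff[OF assms(1)])
  have \<delta>': "\<And>r. r \<in> carrier R \<Longrightarrow> \<delta> r \<in> carrier R"
    "\<And>r s. r \<in> carrier R \<Longrightarrow> s \<in> carrier R \<Longrightarrow> \<delta> (r \<oplus> s) = \<delta> r \<oplus> \<delta> s"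
    "\<And>r s. r \<in> carrier R \<Longrightarrow> s \<in> carrier R \<Longrightarrow> \<delta> (r \<otimes> s) = \<delta> r \<otimes> s \<oplus> r \<otimes> \<delta> s"
    using \<delta> by (auto simp: ring_derivation_def)
  define K where "K = carrier R \<inter> (\<Inter>a\<in>A. residual R I (\<delta> a))"
  have KF: "K \<in> F"
    unfolding K_def using A I I' \<delta>'
    by (intro gabriel_filter_finite_Inter[OF assms(1,2)] gabriel_filter_residual[OF assms(2)]) auto
  have AK: "ideal_prod R A K \<in> F"
    by (rule gabriel_filter_ideal_prod[OF assms(1,2) subset_trans[OF A(3) I'(1)] A(2,4) KF])
  then have closed: "ideal_prod R A K \<subseteq> carrier R"
    by (rule gabriel_filter_subset_carrier[OF assms(1,2)])
  have "\<delta> x \<in> I" if "x \<in> ideal_prod R A K" for x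
    using that
  proof induction
    case (prod a k)
    then have "\<delta> a \<otimes> k \<in> I" "a \<in> I" "a \<in> carrier R" "k \<in> carrier R"
      using A I' by (auto simp: K_def residual_def)
    then show ?case using I' \<delta>' by simp
  next
    case (sum x y)
    then have "x \<in> carrier R" "y \<in> carrier R" using closed by auto
    then show ?case using sum.IH I' \<delta>' by simp
  qed
  then show "\<exists>J\<in>F. \<delta> ` J \<subseteq> I" using AK by auto
qed

section \<open>Perfect filters\<close>

text \<open>\<open>\<phi>(I) Q\<close> is a right ideal of \<open>Q\<close>, so it equals \<open>Q\<close> exactly when it contains \<open>1\<close>, and finitely
  many elements of \<open>I\<close> already account for \<open>1\<close>.\<close>

lemma perfect_filter_finitely_generated_member:
  assumes "ring R" "ring Q" "\<phi> \<in> ring_hom R Q" "perfect_filter R F Q \<phi>" "I \<in> F"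
  shows "\<exists>A. finite A \<and> A \<noteq> {} \<and> A \<subseteq> I \<and> ideal_prod R A (carrier R) \<in> F"
proof -
  interpret R: ring R by fact
  interpret Q: ring Q by fact
  have F: "F = {I. right_ideal I R \<and> ideal_prod Q (\<phi> ` I) (carrier Q) = carrier Q}"
    using assms by (simp add: perfect_filter_def)
  have I: "I \<subseteq> carrier R"
    using assms(5) by (auto simp: F right_ideal_iff[OF assms(1)])
  have "\<one>\<^bsub>Q\<^esub> \<in> ideal_prod Q (\<phi> ` I) (carrier Q)"
    using assms(5) by (simp add: F)
  then obtain A where A: "finite A" "A \<subseteq> I" "A \<noteq> {}"
    and one: "\<one>\<^bsub>Q\<^esub> \<in> ideal_prod Q (\<phi> ` A) (carrier Q)"
    by (rule ideal_prod_finite_support)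
  let ?AR = "ideal_prod R A (carrier R)"
  have AR: "right_ideal ?AR R"
    using A I by (intro ideal_prod_right_ideal)
      (auto simp: assms(1) right_ideal_iff[OF assms(1)])
  have "A \<subseteq> ?AR"
  proof
    fix a assume "a \<in> A"
    then have "a \<otimes>\<^bsub>R\<^esub> \<one>\<^bsub>R\<^esub> \<in> ?AR" "a \<in> carrier R"
      using A I by (auto intro: ideal_prod.prod)
    then show "a \<in> ?AR" by simp
  qed
  then have one': "\<one>\<^bsub>Q\<^esub> \<in> ideal_prod Q (\<phi> ` ?AR) (carrier Q)"
    by (intro ideal_prod_mono[OF one] image_mono order_refl)
  have "\<phi> ` ?AR \<subseteq> carrier Q" "\<phi> ` ?AR \<noteq> {}"
    using AR assms(3) by (auto simp: right_ideal_iff[OF assms(1)] ring_hom_def)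
  then have "right_ideal (ideal_prod Q (\<phi> ` ?AR) (carrier Q)) Q"
    by (intro ideal_prod_right_ideal) (auto simp: assms(2) right_ideal_iff[OF assms(2)])
  then have "ideal_prod Q (\<phi> ` ?AR) (carrier Q) \<subseteq> carrier Q"
    "\<And>q. q \<in> carrier Q \<Longrightarrow> \<one>\<^bsub>Q\<^esub> \<otimes>\<^bsub>Q\<^esub> q \<in> ideal_prod Q (\<phi> ` ?AR) (carrier Q)"
    using one' by (auto simp: right_ideal_iff[OF assms(2)])
  then have "ideal_prod Q (\<phi> ` ?AR) (carrier Q) = carrier Q"
    by fastforce
  then have "?AR \<in> F"
    using AR by (simp add: F)
  then show ?thesis using A by blast
qed

theorem proposition4:
  fixes R :: "('a, 'm) ring_scheme"
    and F :: "'a set set"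
    and E :: "('a, 'e, 'k) right_module_scheme"
    and j :: "'a set \<Rightarrow> 'e"
    and Q :: "('e, 'q) ring_scheme"
  assumes "ring R"
    and "gabriel_filter R F"
    and "right_ring_of_quotients R F E j Q"
    and "perfect_filter R F Q (canonical_map R F j)"
  shows "differential_filter R F"
proof (rule differential_if_finitely_generated_members[OF assms(1,2)])
  have "ring Q" "canonical_map R F j \<in> ring_hom R Q"
    using assms(3) by (auto simp: right_ring_of_quotients_def)
  then show "\<exists>A. finite A \<and> A \<noteq> {} \<and> A \<subseteq> I \<and> ideal_prod R A (carrier R) \<in> F" if "I \<in> F" for I
    using perfect_filter_finitely_generated_member[OF assms(1) _ _ assms(4) that] by simp
qed

end
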